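(* Let $k\ge 1$ be an integer and let $f$ be a real function of class $C^{k+1}$ (defined on $[0,\infty)$) satisfying $f(0)=f'(0)=\dots=f^{(k)}(0)=0$ and $f^{(k+1)}(0)\neq 0$. Let $r_0:\mathbb{S}^2\to(0,\infty)$ be the radial function of a $C^3$-smooth convex body in $\mathbb{R}^3$ containing the origin in its interior. For each $u\in\mathbb{S}^2$ let $r(u,t)$, $t\ge 0$, be the solution of $r_t(u,t)=f(r(u,t))$ with $r(u,0)=r_0(u)$. Let $M(t)=\max\{r(u,t):u\in\mathbb{S}^2\}$, and assume that $f(r)<0$ for all $r\in(0,M(0)]$. Then $\frac{r(u,t)}{M(t)}$ converges to $1$ uniformly on $\mathbb{S}^2$ as $t\to\infty$.
   Context: $\mathbb{S}^2$ is the Euclidean unit sphere in $\mathbb{R}^3$. The equation $r_t=f(r)$ (a radial distance-driven flow) is a family of decoupled ordinary differential equations, one for each direction $u$, where $r(u,t)$ is the distance from the origin of the boundary point in direction $u$ at time $t$; subscript $t$ denotes the time derivative. The radial function of a convex body $K$ containing the origin in its interior is $u\mapsto\max\{s\ge0: su\in K\}$. *)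

theory Defs
  imports "HOL-Analysis.Analysis"
begin

text \<open>
  Derivatives are taken within \<open>S\<close>, so for \<open>S = {0..}\<close> they are one-sided
  at \<open>0\<close>, and the values of \<open>f\<close> outside \<open>S\<close> play no role.
\<close>
fun nth_derivative_within :: "real set \<Rightarrow> nat \<Rightarrow> (real \<Rightarrow> real) \<Rightarrow> real \<Rightarrow> real" where
  "nth_derivative_within S 0 f = f"
| "nth_derivative_within S (Suc n) f =
     (\<lambda>x. vector_derivative (nth_derivative_within S n f) (at x within S))"

definition C_class_within :: "real set \<Rightarrow> nat \<Rightarrow> (real \<Rightarrow> real) \<Rightarrow> bool" where
  "C_class_within S n f \<longleftrightarrow>
     (\<forall>j<n. nth_derivative_within S j f differentiable_on S) \<and>
     continuous_on S (nth_derivative_within S n f)"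

text \<open>Functions of several variables of class \<open>C\<^sup>n\<close> on an open set \<open>U\<close>.\<close>
fun C_class_on :: "nat \<Rightarrow> 'a::euclidean_space set \<Rightarrow> ('a \<Rightarrow> real) \<Rightarrow> bool" where
  "C_class_on 0 U g \<longleftrightarrow> continuous_on U g"
| "C_class_on (Suc n) U g \<longleftrightarrow>
     (\<forall>x\<in>U. g differentiable (at x)) \<and>
     (\<forall>v. C_class_on n U (\<lambda>x. frechet_derivative g (at x) v))"

text \<open>Regular hypersurface of class \<open>C\<^sup>n\<close>: locally the zero set of a \<open>C\<^sup>n\<close> function
  without critical points on it.\<close>
definition C_hypersurface :: "nat \<Rightarrow> 'a::euclidean_space set \<Rightarrow> bool" where
  "C_hypersurface n H \<longleftrightarrow>
     (\<forall>p\<in>H. \<exists>U g. open U \<and> p \<in> U \<and> C_class_on n U g \<and>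
        H \<inter> U = {x \<in> U. g x = 0} \<and>
        (\<forall>x\<in>H \<inter> U. frechet_derivative g (at x) \<noteq> (\<lambda>v. 0)))"

definition convex_body :: "'a::euclidean_space set \<Rightarrow> bool" where
  "convex_body K \<longleftrightarrow> convex K \<and> compact K \<and> interior K \<noteq> {}"

definition C_smooth_convex_body :: "nat \<Rightarrow> 'a::euclidean_space set \<Rightarrow> bool" where
  "C_smooth_convex_body n K \<longleftrightarrow> convex_body K \<and> C_hypersurface n (frontier K)"

text \<open>Maximum of a possibly infinite set; unspecified if there is no largest element.\<close>
definition maximum :: "real set \<Rightarrow> real" where
  "maximum A = (GREATEST s. s \<in> A)"

definition radial_function :: "'a::euclidean_space set \<Rightarrow> 'a \<Rightarrow> real" where
  "radial_function K u = maximum {s. 0 \<le> s \<and> s *\<^sub>R u \<in> K}"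

text \<open>
  Forward solution of \<open>y' = f y\<close>, \<open>y 0 = a\<close>, for a right-hand side defined on
  \<open>{0..}\<close>; the first conjunct keeps the solution in that domain.
\<close>
definition solves_flow :: "(real \<Rightarrow> real) \<Rightarrow> real \<Rightarrow> (real \<Rightarrow> real) \<Rightarrow> bool" where
  "solves_flow f a y \<longleftrightarrow>
     (\<forall>t\<ge>0. 0 \<le> y t) \<and>
     y 0 = a \<and>
     (\<forall>t\<ge>0. (y has_real_derivative f (y t)) (at t within {0..}))"

end

theory Submission
  imports Defs
begin

text \<open>
  Since \<open>f 0 = f' 0 = 0\<close>, the relative speed \<open>f s / s\<close> tends to \<open>0\<close> as \<open>s\<close> does: small solutions
  move ever more slowly in proportion to their size, and a head start of bounded duration is
  forgotten in the limit.

  Let \<open>x\<close> be a longest vector of \<open>K\<close> and \<open>Y\<close> the solution in its direction. Since \<open>f\<close> is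
  \<open>C\<^sup>1\<close>, it is locally Lipschitz, so solutions never cross (\<open>flow_comparison\<close>); hence
  \<open>Y\<close> stays the largest of all solutions and \<open>M = Y\<close>.

  As \<open>f < 0\<close> on \<open>(0, M 0]\<close>, the solution \<open>Y\<close> decreases to \<open>0\<close> (\<open>flow_reaches_level\<close>). If a ball
  of radius \<open>\<delta>\<close> about the origin lies in \<open>K\<close> and \<open>T\<close> is a time with \<open>Y T \<le> \<delta>\<close>, then,
  the flow being autonomous, comparison squeezes every solution between two time shifts of \<open>Y\<close>:
  \<open>Y (t + T) \<le> r u t \<le> Y t\<close>, with \<open>T\<close> independent of \<open>u\<close>. Finally, the logarithmic derivative
  \<open>f Y / Y\<close> of \<open>Y\<close> tends to \<open>0\<close>, so over a time interval of the fixed length \<open>T\<close> the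
  relative change of \<open>Y\<close> tends to \<open>0\<close> (\<open>flow_decay_rate\<close>), and both bounds of \<open>r u t / Y t\<close>
  tend to \<open>1\<close>.
\<close>

section \<open>Comparison for scalar flows\<close>

lemma mono_of_deriv_within:
  fixes g :: "real \<Rightarrow> real"
  assumes deriv: "\<And>t. 0 \<le> t \<Longrightarrow> (g has_real_derivative g' t) (at t within {0..})"
    and ab: "0 \<le> a" "a \<le> b"
    and nonneg: "\<And>t. a < t \<Longrightarrow> t < b \<Longrightarrow> 0 \<le> g' t"
  shows "g a \<le> g b"
proof (rule DERIV_nonneg_imp_increasing_open[OF ab(2)])
  fix t assume t: "a < t" "t < b"
  then have "at t within {0..} = at t"
    using ab by (intro at_within_interior) auto
  with deriv[of t] nonneg[of t] t ab show "\<exists>y. DERIV g t :> y \<and> 0 \<le> y"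
    by auto
next
  have "continuous_on {0..} g"
    using deriv DERIV_continuous by (fastforce simp: continuous_on_eq_continuous_within)
  then show "continuous_on {a..b} g"
    by (rule continuous_on_subset) (use ab in auto)
qed

definition lipschitz_on_bounded :: "(real \<Rightarrow> real) \<Rightarrow> bool" where
  "lipschitz_on_bounded f \<longleftrightarrow>
     (\<forall>B. \<exists>L. \<forall>a\<in>{0..B}. \<forall>b\<in>{0..B}. \<bar>f a - f b\<bar> \<le> L * \<bar>a - b\<bar>)"

lemma C1_imp_lipschitz_on_bounded:
  fixes f :: "real \<Rightarrow> real"
  assumes deriv: "\<And>s. 0 \<le> s \<Longrightarrow> (f has_real_derivative f' s) (at s within {0..})"
    and cont: "continuous_on {0..} f'"
  shows "lipschitz_on_bounded f"
  unfolding lipschitz_on_bounded_def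
proof
  fix B :: real
  have "compact (f' ` {0..B})"
    by (intro compact_continuous_image continuous_on_subset[OF cont]) auto
  then obtain L where L: "\<And>s. s \<in> {0..B} \<Longrightarrow> norm (f' s) \<le> L"
    using compact_imp_bounded bounded_iff by (metis imageI)
  have "norm (f a - f b) \<le> L * norm (a - b)" if "a \<in> {0..B}" "b \<in> {0..B}" for a b
  proof (rule field_differentiable_bound[where S = "{0..B}" and f' = f'])
    show "(f has_field_derivative f' s) (at s within {0..B})" if "s \<in> {0..B}" for s
      using deriv[of s] that by (auto intro: has_field_derivative_subset)
  qed (use L that in auto)
  then show "\<exists>L. \<forall>a\<in>{0..B}. \<forall>b\<in>{0..B}. \<bar>f a - f b\<bar> \<le> L * \<bar>a - b\<bar>"
    unfolding real_norm_def by blast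
qed

text \<open>
  After the last time at which \<open>y \<le> x\<close>, the difference \<open>w = x - y\<close> is negative and satisfies
  \<open>w' \<ge> L w\<close>, so that \<open>w exp (- L t)\<close> cannot decrease. It starts from a nonnegative value,
  hence \<open>w\<close> could not have become negative. Allowing differential inequalities lets constants
  serve as barriers.
\<close>
lemma flow_comparison:
  fixes x y :: "real \<Rightarrow> real"
  assumes lip: "lipschitz_on_bounded f"
    and dx: "\<And>t. 0 \<le> t \<Longrightarrow> (x has_real_derivative x' t) (at t within {0..})"
    and dy: "\<And>t. 0 \<le> t \<Longrightarrow> (y has_real_derivative y' t) (at t within {0..})"
    and x_nonneg: "\<And>t. 0 \<le> t \<Longrightarrow> 0 \<le> x t"
    and y_nonneg: "\<And>t. 0 \<le> t \<Longrightarrow> 0 \<le> y t"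
    and super: "\<And>t. 0 \<le> t \<Longrightarrow> f (x t) \<le> x' t"
    and sub: "\<And>t. 0 \<le> t \<Longrightarrow> y' t \<le> f (y t)"
    and init: "y 0 \<le> x 0"
    and t1: "0 \<le> t1"
  shows "y t1 \<le> x t1"
proof (rule ccontr)
  assume neg: "\<not> y t1 \<le> x t1"
  have "continuous_on {0..} x" "continuous_on {0..} y"
    using dx dy DERIV_continuous by (fastforce simp: continuous_on_eq_continuous_within)+
  then have cont: "continuous_on {0..t1} x" "continuous_on {0..t1} y"
    by (auto intro: continuous_on_subset)
  have "compact (x ` {0..t1} \<union> y ` {0..t1})"
    by (intro compact_Un compact_continuous_image cont compact_Icc)
  then obtain B where B: "\<And>s. s \<in> x ` {0..t1} \<union> y ` {0..t1} \<Longrightarrow> norm s \<le> B"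
    using compact_imp_bounded bounded_iff by metis
  obtain L where L: "\<And>a b. a \<in> {0..B} \<Longrightarrow> b \<in> {0..B} \<Longrightarrow> \<bar>f a - f b\<bar> \<le> L * \<bar>a - b\<bar>"
    using lip unfolding lipschitz_on_bounded_def by blast
  define A where "A = {t \<in> {0..t1}. y t \<le> x t}"
  have "closed A"
    unfolding A_def using cont by (intro continuous_on_closed_Collect_le) auto
  then have "compact A"
    unfolding A_def by (metis (no_types, lifting) bounded_closed_interval bounded_subset
        compact_eq_bounded_closed mem_Collect_eq subsetI)
  moreover have "0 \<in> A"
    using init t1 by (simp add: A_def)
  ultimately obtain t0 where t0: "t0 \<in> A" "\<And>t. t \<in> A \<Longrightarrow> t \<le> t0"
    using compact_attains_sup[of A] by blast
  define g where "g t = (x t - y t) * exp (- L * t)" for t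
  have "g t0 \<le> g t1"
  proof (rule mono_of_deriv_within[where g = g])
    show "(g has_real_derivative (x' t - y' t - L * (x t - y t)) * exp (- L * t))
            (at t within {0..})" if "0 \<le> t" for t
      unfolding g_def
      by (rule derivative_eq_intros dx[OF that] dy[OF that] refl)+ (simp add: algebra_simps)
    show "0 \<le> t0" "t0 \<le> t1"
      using t0(1) by (auto simp: A_def)
    fix t assume t: "t0 < t" "t < t1"
    with \<open>0 \<le> t0\<close> have t': "t \<in> {0..t1}" by auto
    then have lt: "x t < y t"
      using t0(2)[of t] t by (force simp: A_def)
    have "x t \<in> {0..B}" "y t \<in> {0..B}"
      using B[of "x t"] B[of "y t"] x_nonneg[of t] y_nonneg[of t] t' by auto
    from L[OF this] lt have "L * (x t - y t) \<le> f (x t) - f (y t)"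
      by (simp add: algebra_simps abs_if split: if_splits)
    also have "\<dots> \<le> x' t - y' t"
      using super[of t] sub[of t] t' by auto
    finally show "0 \<le> (x' t - y' t - L * (x t - y t)) * exp (- L * t)"
      by simp
  qed
  moreover have "0 \<le> g t0"
    using t0(1) by (simp add: g_def A_def)
  moreover have "g t1 < 0"
    using neg by (simp add: g_def mult_neg_pos)
  ultimately show False
    by simp
qed

section \<open>Long-time behaviour of a single solution\<close>

lemma solves_flow_deriv:
  "solves_flow f a y \<Longrightarrow> 0 \<le> t \<Longrightarrow> (y has_real_derivative f (y t)) (at t within {0..})"
  by (simp add: solves_flow_def)

lemma solves_flow_nonneg: "solves_flow f a y \<Longrightarrow> 0 \<le> t \<Longrightarrow> 0 \<le> y t"
  by (simp add: solves_flow_def)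

lemma solves_flow_init: "solves_flow f a y \<Longrightarrow> y 0 = a"
  by (simp add: solves_flow_def)

lemma solves_flow_mono:
  assumes "lipschitz_on_bounded f" "solves_flow f a y" "solves_flow f b x" "a \<le> b" "0 \<le> t"
  shows "y t \<le> x t"
  by (rule flow_comparison[OF assms(1) solves_flow_deriv[OF assms(3)] solves_flow_deriv[OF assms(2)]])
    (use assms in \<open>auto simp: solves_flow_nonneg solves_flow_init\<close>)

lemma solves_flow_shift:
  assumes y: "solves_flow f a y" and T: "0 \<le> T"
  shows "solves_flow f (y T) (\<lambda>t. y (t + T))"
  unfolding solves_flow_def
proof (intro conjI allI impI)
  fix t :: real assume t: "0 \<le> t"
  show "0 \<le> y (t + T)"
    using solves_flow_nonneg[OF y] t T by simp
  have "(y has_real_derivative f (y (t + T))) (at (t + T) within (\<lambda>t. t + T) ` {0..})"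
    by (rule has_field_derivative_subset[OF solves_flow_deriv[OF y]]) (use t T in auto)
  then have "(y \<circ> (\<lambda>t. t + T) has_real_derivative f (y (t + T)) * 1) (at t within {0..})"
    by (rule DERIV_image_chain) (auto intro!: derivative_eq_intros)
  then show "((\<lambda>t. y (t + T)) has_real_derivative f (y (t + T))) (at t within {0..})"
    by (simp add: comp_def)
qed simp

lemma solves_flow_le_init:
  assumes lip: "lipschitz_on_bounded f" and y: "solves_flow f a y"
    and a: "0 \<le> a" "f a \<le> 0" and t: "0 \<le> t"
  shows "y t \<le> a"
  using lip _ solves_flow_deriv[OF y] _ solves_flow_nonneg[OF y] _ _ _ t
  by (rule flow_comparison[where x = "\<lambda>_. a" and x' = "\<lambda>_. 0"])
    (use a solves_flow_init[OF y] in auto)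

text \<open>
  The factor \<open>exp (- \<eta> s)\<close> bounds the decay of \<open>y\<close> as long as \<open>f\<close> is at least \<open>- \<eta>\<close> times the
  identity along it: then \<open>y exp (\<eta> t)\<close> has nonnegative derivative.
\<close>
lemma flow_decay_rate:
  assumes y: "solves_flow f a y" and "0 \<le> t" "0 \<le> s"
    and rate: "\<And>v. t < v \<Longrightarrow> v < t + s \<Longrightarrow> - \<eta> * y v \<le> f (y v)"
  shows "y t * exp (- \<eta> * s) \<le> y (t + s)"
proof -
  have "y t * exp (\<eta> * t) \<le> y (t + s) * exp (\<eta> * (t + s))"
  proof (rule mono_of_deriv_within[where g = "\<lambda>v. y v * exp (\<eta> * v)"])
    show "((\<lambda>v. y v * exp (\<eta> * v)) has_real_derivative (f (y v) + \<eta> * y v) * exp (\<eta> * v))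
            (at v within {0..})" if "0 \<le> v" for v
      by (rule derivative_eq_intros solves_flow_deriv[OF y that] refl)+ (simp add: algebra_simps)
    show "0 \<le> (f (y v) + \<eta> * y v) * exp (\<eta> * v)" if "t < v" "v < t + s" for v
      using rate[OF that] by simp
  qed (use assms in auto)
  then have "y t * exp (\<eta> * t) * exp (- \<eta> * (t + s)) \<le>
             y (t + s) * exp (\<eta> * (t + s)) * exp (- \<eta> * (t + s))"
    by (rule mult_right_mono) simp
  then show ?thesis
    by (simp add: mult.assoc exp_add[symmetric] algebra_simps)
qed

lemma solves_flow_pos:
  assumes lip: "lipschitz_on_bounded f" and y: "solves_flow f a y"
    and a: "0 < a" "f a \<le> 0" and f0: "f 0 = 0" and t: "0 \<le> t"
  shows "0 < y t"
proof -
  obtain L where L: "\<And>b c. b \<in> {0..a} \<Longrightarrow> c \<in> {0..a} \<Longrightarrow> \<bar>f b - f c\<bar> \<le> L * \<bar>b - c\<bar>"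
    using lip unfolding lipschitz_on_bounded_def by blast
  have "- L * y v \<le> f (y v)" if "0 < v" for v
    using L[of "y v" 0] solves_flow_le_init[OF lip y, of v] solves_flow_nonneg[OF y, of v] a f0 that
    by auto
  then have "y 0 * exp (- L * t) \<le> y (0 + t)"
    by (intro flow_decay_rate[OF y]) (use t in auto)
  moreover have "0 < y 0 * exp (- L * t)"
    using a solves_flow_init[OF y] by simp
  ultimately show ?thesis
    by simp
qed

text \<open>
  Above the level \<open>\<epsilon>\<close> the speed is bounded away from \<open>0\<close> by compactness, so the solution would
  have to become negative if it stayed there forever.
\<close>
lemma flow_reaches_level:
  assumes lip: "lipschitz_on_bounded f" and cont: "continuous_on {0..} f"
    and y: "solves_flow f a y" and a: "0 < a" and f0: "f 0 = 0"
    and neg: "\<And>s. 0 < s \<Longrightarrow> s \<le> a \<Longrightarrow> f s < 0"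
    and eps: "0 < \<epsilon>"
  shows "\<exists>T\<ge>0. \<forall>t\<ge>T. y t \<le> \<epsilon>"
proof -
  have le_a: "y t \<le> a" if "0 \<le> t" for t
    using solves_flow_le_init[OF lip y _ _ that] a neg[of a] by simp
  have "\<exists>T\<ge>0. y T \<le> \<epsilon>"
  proof (rule ccontr)
    assume "\<not> ?thesis"
    then have gt: "\<epsilon> < y t" if "0 \<le> t" for t
      using that by force
    have "\<epsilon> \<le> a"
      using gt[of 0] solves_flow_init[OF y] by simp
    then obtain s0 where s0: "s0 \<in> {\<epsilon>..a}" "\<And>s. s \<in> {\<epsilon>..a} \<Longrightarrow> f s \<le> f s0"
      using continuous_attains_sup[of "{\<epsilon>..a}" f] continuous_on_subset[OF cont, of "{\<epsilon>..a}"] eps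
      by auto
    have c: "f s0 < 0"
      using neg s0(1) eps by auto
    \<comment> \<open>The time at which a solution starting at \<open>a\<close> with constant velocity \<open>f s0\<close> would reach \<open>0\<close>.\<close>
    define t where "t = a / (- f s0)"
    have t: "0 \<le> t"
      using a c by (simp add: t_def divide_nonneg_neg)
    have "f s0 * 0 - y 0 \<le> f s0 * t - y t"
    proof (rule mono_of_deriv_within[where g = "\<lambda>v. f s0 * v - y v"])
      show "((\<lambda>v. f s0 * v - y v) has_real_derivative f s0 - f (y v)) (at v within {0..})"
        if "0 \<le> v" for v
        by (rule derivative_eq_intros solves_flow_deriv[OF y that] refl)+ simp
      show "0 \<le> f s0 - f (y v)" if "0 < v" for v
        using s0(2)[of "y v"] gt[of v] le_a[of v] that by simp
    qed (use t in auto)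
    moreover have "f s0 * t = - a"
      using c by (simp add: t_def)
    ultimately show False
      using gt[OF t] eps solves_flow_init[OF y] by simp
  qed
  then obtain T where T: "0 \<le> T" "y T \<le> \<epsilon>"
    by blast
  have "y t \<le> \<epsilon>" if "T \<le> t" for t
  proof -
    have "f (y T) \<le> 0"
      using neg[of "y T"] le_a[OF T(1)] solves_flow_pos[OF lip y a _ f0 T(1)] neg[of a] a by simp
    then have "y (t - T + T) \<le> y T"
      using solves_flow_le_init[OF lip solves_flow_shift[OF y T(1)], of "t - T"]
        solves_flow_nonneg[OF y T(1)] that by simp
    then show ?thesis
      using T(2) by simp
  qed
  with T(1) show ?thesis
    by blast
qed

section \<open>Longest vectors and the radial function\<close>

lemma maximum_eqI:
  assumes "m \<in> A" "\<And>s. s \<in> A \<Longrightarrow> s \<le> m"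
  shows "maximum A = m"
  unfolding maximum_def using assms by (intro Greatest_equality) auto

lemma radial_function_props:
  fixes K :: "'a::euclidean_space set"
  assumes K: "compact K" "0 \<in> K" and u: "norm u = 1"
  shows radial_function_mem: "radial_function K u *\<^sub>R u \<in> K"
    and radial_function_nonneg: "0 \<le> radial_function K u"
    and radial_function_upper: "\<And>s. 0 \<le> s \<Longrightarrow> s *\<^sub>R u \<in> K \<Longrightarrow> s \<le> radial_function K u"
proof -
  define A where "A = {s. 0 \<le> s \<and> s *\<^sub>R u \<in> K}"
  have "closed ((\<lambda>s. s *\<^sub>R u) -` K)"
    using K by (intro closed_vimage) (auto intro: compact_imp_closed continuous_intros)
  then have "closed A"
    unfolding A_def vimage_def by (intro closed_Collect_conj) (auto intro: closed_Collect_le continuous_intros)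
  moreover have "bounded A"
  proof -
    obtain B where "\<And>x. x \<in> K \<Longrightarrow> norm x \<le> B"
      using compact_imp_bounded[OF K(1)] bounded_iff by metis
    then have "norm s \<le> B" if "s \<in> A" for s
      using that u by (force simp: A_def)
    then show ?thesis
      using bounded_iff by blast
  qed
  moreover have "0 \<in> A"
    using K by (simp add: A_def)
  ultimately obtain m where m: "m \<in> A" "\<And>s. s \<in> A \<Longrightarrow> s \<le> m"
    using compact_attains_sup[of A] compact_eq_bounded_closed by blast
  then have "radial_function K u = m"
    unfolding radial_function_def A_def[symmetric] by (rule maximum_eqI)
  with m show "radial_function K u *\<^sub>R u \<in> K" "0 \<le> radial_function K u"
    "\<And>s. 0 \<le> s \<Longrightarrow> s *\<^sub>R u \<in> K \<Longrightarrow> s \<le> radial_function K u"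
    by (auto simp: A_def)
qed

text \<open>
  The maximum is the largest norm in the compact set \<open>K\<close>, attained in the direction of a longest
  vector; the lower bound is the radius of a ball about the origin contained in \<open>K\<close>.
\<close>
lemma radial_function_attains_max:
  fixes K :: "'a::euclidean_space set"
  assumes K: "compact K" "0 \<in> interior K"
  obtains u0 \<delta> where "u0 \<in> sphere 0 1" "0 < \<delta>"
    "\<And>u. u \<in> sphere 0 1 \<Longrightarrow> \<delta> \<le> radial_function K u"
    "\<And>u. u \<in> sphere 0 1 \<Longrightarrow> radial_function K u \<le> radial_function K u0"
proof -
  obtain \<delta> where \<delta>: "0 < \<delta>" "cball 0 \<delta> \<subseteq> K"
    using K(2) mem_interior_cball by blast
  have 0: "0 \<in> K"
    using K(2) interior_subset by blast
  note radial = radial_function_props[OF K(1) 0]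
  have lower: "\<delta> \<le> radial_function K u" if "u \<in> sphere 0 1" for u
    using radial(3)[of u \<delta>] \<delta> that by (auto simp: subset_iff)
  obtain x where x: "x \<in> K" "\<And>z. z \<in> K \<Longrightarrow> norm z \<le> norm x"
    using continuous_attains_sup[OF K(1), of norm] 0 continuous_on_norm_id by blast
  obtain b :: 'a where "norm b = \<delta>"
    using vector_choose_size[of \<delta>] \<delta> by auto
  then have x_pos: "0 < norm x"
    using x(2)[of b] \<delta> by (auto simp: subset_iff)
  define u0 where "u0 = x /\<^sub>R norm x"
  have u0: "u0 \<in> sphere 0 1"
    using x_pos by (simp add: u0_def)
  have "norm x *\<^sub>R u0 \<in> K"
    using x(1) x_pos by (simp add: u0_def)
  then have "norm x \<le> radial_function K u0"
    using radial(3)[of u0] u0 by simp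
  moreover have "radial_function K u \<le> norm x" if "u \<in> sphere 0 1" for u
    using x(2)[OF radial(1), of u] radial(2)[of u] that by simp
  ultimately show ?thesis
    using that[OF u0 \<delta>(1) lower] by fastforce
qed

section \<open>Uniform convergence of the normalized radii\<close>

text \<open>
  The squeeze between time shifts, for an arbitrary family of initial values that is bounded
  below by \<open>\<delta>\<close> and has a largest member.
\<close>
lemma flow_ratio_uniform_limit:
  fixes r :: "'i \<Rightarrow> real \<Rightarrow> real"
  assumes deriv: "\<And>s. 0 \<le> s \<Longrightarrow> (f has_real_derivative f' s) (at s within {0..})"
    and cont: "continuous_on {0..} f'"
    and f0: "f 0 = 0" "f' 0 = 0"
    and sol: "\<And>u. u \<in> I \<Longrightarrow> solves_flow f (a u) (r u)"
    and u0: "u0 \<in> I" and \<delta>: "0 < \<delta>"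
    and lower: "\<And>u. u \<in> I \<Longrightarrow> \<delta> \<le> a u"
    and upper: "\<And>u. u \<in> I \<Longrightarrow> a u \<le> a u0"
    and neg: "\<And>s. 0 < s \<Longrightarrow> s \<le> a u0 \<Longrightarrow> f s < 0"
  shows "uniform_limit I (\<lambda>t u. r u t / r u0 t) (\<lambda>u. 1) at_top"
  unfolding uniform_limit_iff
proof (intro allI impI)
  fix e :: real assume e: "0 < e"
  have lip: "lipschitz_on_bounded f"
    using deriv cont by (rule C1_imp_lipschitz_on_bounded)
  have contf: "continuous_on {0..} f"
    using deriv DERIV_continuous by (fastforce simp: continuous_on_eq_continuous_within)
  have a0: "0 < a u0"
    using lower[OF u0] \<delta> by simp
  note Y = sol[OF u0]
  note level = flow_reaches_level[OF lip contf Y a0 f0(1) neg]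
  have Y_pos: "0 < r u0 t" if "0 \<le> t" for t
    using solves_flow_pos[OF lip Y a0 _ f0(1) that] neg[of "a u0"] a0 by simp
  obtain T where T: "0 \<le> T" "r u0 T \<le> \<delta>"
    using level[OF _ _ \<delta>] by auto
  \<comment> \<open>The relative loss of the largest solution over a time interval of length \<open>T\<close> is at most \<open>\<eta> * T < e\<close>.\<close>
  define \<eta> where "\<eta> = e / (T + 1)"
  have \<eta>: "0 < \<eta>" "\<eta> * T < e"
    using e T by (auto simp: \<eta>_def field_simps)
  have "((\<lambda>s. f s / s) \<longlongrightarrow> 0) (at 0 within {0..})"
    using deriv[of 0] f0 by (simp add: has_field_derivative_iff)
  then have "\<forall>\<^sub>F s in at 0 within {0..}. dist (f s / s) 0 < \<eta>"
    using \<eta>(1) by (rule tendstoD)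
  then obtain d where d: "0 < d"
    "\<And>s. 0 \<le> s \<Longrightarrow> s \<noteq> 0 \<Longrightarrow> \<bar>s\<bar> < d \<Longrightarrow> \<bar>f s / s\<bar> < \<eta>"
    by (auto simp: eventually_at)
  obtain T' where T': "0 \<le> T'" "\<And>t. T' \<le> t \<Longrightarrow> r u0 t \<le> d / 2"
    using level[of "d / 2"] d(1) by auto
  have "dist (r u t / r u0 t) 1 < e" if t: "T' \<le> t" and u: "u \<in> I" for t u
  proof -
    have t0: "0 \<le> t"
      using t T' by simp
    have rate: "- \<eta> * r u0 v \<le> f (r u0 v)" if "t < v" for v
    proof -
      have pos: "0 < r u0 v"
        using Y_pos that t0 by simp
      have "\<bar>f (r u0 v) / r u0 v\<bar> < \<eta>"
        using d(2)[of "r u0 v"] pos T'(2)[of v] that t d(1) by simp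
      then show ?thesis
        using pos by (simp add: abs_less_iff field_simps)
    qed
    have "1 - \<eta> * T \<le> exp (- \<eta> * T)"
      using exp_ge_add_one_self[of "- \<eta> * T"] by simp
    then have "(1 - \<eta> * T) * r u0 t \<le> r u0 t * exp (- \<eta> * T)"
      using Y_pos[OF t0] by (simp add: mult.commute)
    also have "\<dots> \<le> r u0 (t + T)"
      using rate by (intro flow_decay_rate[OF Y t0 T(1)])
    also have "\<dots> \<le> r u t"
      using solves_flow_mono[OF lip solves_flow_shift[OF Y T(1)] sol[OF u] _ t0] T(2) lower[OF u]
      by simp
    finally have "1 - \<eta> * T \<le> r u t / r u0 t"
      using Y_pos[OF t0] by (simp add: field_simps)
    moreover have "r u t / r u0 t \<le> 1"
      using solves_flow_mono[OF lip sol[OF u] Y upper[OF u] t0] Y_pos[OF t0] by simp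
    ultimately show ?thesis
      using \<eta>(2) by (simp add: dist_real_def)
  qed
  then show "\<forall>\<^sub>F t in at_top. \<forall>u\<in>I. dist (r u t / r u0 t) 1 < e"
    unfolding eventually_at_top_linorder by blast
qed

theorem theorem1:
  fixes k :: nat
    and f :: "real \<Rightarrow> real"
    and K :: "(real ^ 3) set"
    and r0 :: "real ^ 3 \<Rightarrow> real"
    and r :: "real ^ 3 \<Rightarrow> real \<Rightarrow> real"
    and M :: "real \<Rightarrow> real"
  assumes "k \<ge> 1"
    and "C_class_within {0..} (k + 1) f"
    and "\<forall>j\<le>k. nth_derivative_within {0..} j f 0 = 0"
    and "nth_derivative_within {0..} (k + 1) f 0 \<noteq> 0"
    and "C_smooth_convex_body 3 K"
    and "0 \<in> interior K"
    and "\<forall>u\<in>sphere 0 1. r0 u = radial_function K u"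
    and "\<forall>u\<in>sphere 0 1. solves_flow f (r0 u) (r u)"
    and "\<forall>t\<ge>0. M t = maximum ((\<lambda>u. r u t) ` sphere 0 1)"
    and "\<forall>s. 0 < s \<and> s \<le> M 0 \<longrightarrow> f s < 0"
  shows "uniform_limit (sphere 0 1) (\<lambda>t u. r u t / M t) (\<lambda>u. 1) at_top"
proof -
  define f' where "f' = nth_derivative_within {0..} 1 f"
  have diff: "nth_derivative_within {0..} j f differentiable_on {0..}" if "j < k + 1" for j
    using assms(2) that by (simp add: C_class_within_def)
  have deriv: "(f has_real_derivative f' s) (at s within {0..})" if "0 \<le> s" for s
    using diff[of 0] that
    by (simp add: f'_def differentiable_on_def vector_derivative_works
        has_real_derivative_iff_has_vector_derivative)
  have cont: "continuous_on {0..} f'"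
    using diff[of 1] assms(1) differentiable_imp_continuous_on by (simp add: f'_def)
  have f0: "f 0 = 0" "f' 0 = 0"
    using assms(1,3) by (force simp: f'_def)+
  have lip: "lipschitz_on_bounded f"
    using deriv cont by (rule C1_imp_lipschitz_on_bounded)
  have "compact K"
    using assms(5) by (simp add: C_smooth_convex_body_def convex_body_def)
  then obtain u0 \<delta> where u0: "u0 \<in> sphere 0 1" and \<delta>: "0 < \<delta>"
    and lower: "\<And>u. u \<in> sphere 0 1 \<Longrightarrow> \<delta> \<le> r0 u"
    and upper: "\<And>u. u \<in> sphere 0 1 \<Longrightarrow> r0 u \<le> r0 u0"
    using radial_function_attains_max[OF _ assms(6)] assms(7) by metis
  have sol: "solves_flow f (r0 u) (r u)" if "u \<in> sphere 0 1" for u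
    using assms(8) that by blast
  have M: "M t = r u0 t" if t: "0 \<le> t" for t
  proof -
    have "r u t \<le> r u0 t" if "u \<in> sphere 0 1" for u
      using lip sol[OF that] sol[OF u0] upper[OF that] t by (rule solves_flow_mono)
    then show ?thesis
      using assms(9) t u0 by (auto intro!: maximum_eqI)
  qed
  have "M 0 = r0 u0"
    using M[of 0] solves_flow_init[OF sol[OF u0]] by simp
  then have "uniform_limit (sphere 0 1) (\<lambda>t u. r u t / r u0 t) (\<lambda>u. 1) at_top"
    using flow_ratio_uniform_limit[where a = r0 and r = r, OF deriv cont f0 sol u0 \<delta> lower upper]
      assms(10) by auto
  moreover have "\<forall>\<^sub>F t in at_top. \<forall>u\<in>sphere 0 1. r u t / r u0 t = r u t / M t"
    using eventually_ge_at_top[of 0] by eventually_elim (simp add: M)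
  ultimately show ?thesis
    by (simp add: uniform_limit_cong)
qed

end
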